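(* Let $k$ and $n$ be non-negative integers. Let $p_1,p_2,\dots,p_{k+1}$ be primes such that $p_i\ge 5$ and $p_i\not\equiv 1\pmod 6$ for each $1\le i\le k+1$. Then for any integer $j\not\equiv 0\pmod{p_{k+1}}$, $$B_3\left(p_1^2p_2^2\cdots p_k^2p_{k+1}^2\,n+\frac{p_1^2p_2^2\cdots p_k^2\,p_{k+1}(6j+p_{k+1})-1}{6}\right)\equiv 0\pmod 3.$$
   Context: A partition is called $3$-regular if none of its parts is divisible by $3$. $B_3(n)$ denotes the number of ordered pairs $(\lambda,\mu)$ of $3$-regular partitions such that the sum of all parts of $\lambda$ and $\mu$ equals $n$ (so $B_3(0)=1$); equivalently $\sum_{n\ge 0}B_3(n)q^n=\prod_{k\ge1}\frac{(1-q^{3k})^2}{(1-q^k)^2}$. By convention $B_3(n)=0$ for negative integers $n$. The primes $p_i$ are not assumed distinct; for $k=0$ the product $p_1^2\cdots p_k^2$ is $1$. *)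

theory Defs
  imports "HOL-Number_Theory.Number_Theory" "HOL-Library.Multiset"
begin

text \<open>A partition is the multiset of its parts, which are positive integers.\<close>

definition is_partition :: "nat multiset \<Rightarrow> bool" where
  "is_partition L \<longleftrightarrow> (\<forall>x \<in># L. x > 0)"

definition three_regular :: "nat multiset \<Rightarrow> bool" where
  "three_regular L \<longleftrightarrow> is_partition L \<and> (\<forall>x \<in># L. \<not> 3 dvd x)"

text \<open>The argument is an integer; for negative arguments the set below is empty, so the
  convention that the value is \<open>0\<close> there holds automatically.\<close>

definition B3 :: "int \<Rightarrow> nat" where
  "B3 m = card {(L, M). three_regular L \<and> three_regular M \<and> int (sum_mset L + sum_mset M) = m}"

text \<open>The counted set is finite, so \<^const>\<open>card\<close> is not a default value.\<close>

lemma size_le_sum_mset: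
  assumes "is_partition L"
  shows "size L \<le> sum_mset L"
  using assms by (induction L) (auto simp: is_partition_def)

lemma finite_B3_set:
  "finite {(L, M). three_regular L \<and> three_regular M \<and> int (sum_mset L + sum_mset M) = m}"
proof -
  let ?T = "mset ` {xs. set xs \<subseteq> {..nat m} \<and> length xs \<le> nat m}"
  have fin: "finite ?T"
    by (intro finite_imageI finite_lists_length_le) simp
  have mem: "L \<in> ?T" if L: "three_regular L" "sum_mset L \<le> nat m" for L
  proof -
    obtain xs where xs: "mset xs = L" using ex_mset by blast
    have "size L \<le> nat m"
      using L size_le_sum_mset[of L] by (simp add: three_regular_def)
    then have "length xs \<le> nat m" using xs by (simp flip: size_mset)
    moreover have "x \<le> nat m" if x: "x \<in># L" for x
    proof -
      obtain N where "L = add_mset x N" using x by (meson mset_add)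
      then show ?thesis using L by simp
    qed
    then have "set xs \<subseteq> {..nat m}" using xs by auto
    ultimately show ?thesis using xs by blast
  qed
  show ?thesis
  proof (rule finite_subset)
    show "{(L, M). three_regular L \<and> three_regular M \<and> int (sum_mset L + sum_mset M) = m} \<subseteq> ?T \<times> ?T"
    proof (rule subrelI)
      fix L M
      assume "(L, M) \<in> {(L, M). three_regular L \<and> three_regular M \<and> int (sum_mset L + sum_mset M) = m}"
      then have "three_regular L" "three_regular M" and sum: "int (sum_mset L + sum_mset M) = m"
        by blast+
      moreover have "sum_mset L \<le> nat m" "sum_mset M \<le> nat m"
        unfolding sum[symmetric] nat_int by simp_all
      ultimately have *: "three_regular L" "three_regular M" "sum_mset L \<le> nat m" "sum_mset M \<le> nat m"
        by simp_all
      show "(L, M) \<in> ?T \<times> ?T"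
        by (rule SigmaI) (rule mem[OF *(1,3)], rule mem[OF *(2,4)])
    qed
    show "finite (?T \<times> ?T)" using fin by simp
  qed
qed

text \<open>The division by \<open>6\<close> used in the argument of \<^const>\<open>B3\<close> is exact.\<close>

lemma exact_division:
  fixes p :: "nat \<Rightarrow> nat" and j :: int
  assumes "\<And>i. i \<in> {1..k+1} \<Longrightarrow> prime (p i)" and "\<And>i. i \<in> {1..k+1} \<Longrightarrow> p i \<ge> 5"
  shows "6 dvd (\<Prod>i=1..k. int (p i) ^ 2) * int (p (k+1)) * (6 * j + int (p (k+1))) - 1"
proof -
  have sq: "[int (p i) ^ 2 = 1] (mod 6)" if i: "i \<in> {1..k+1}" for i
  proof -
    have "\<not> 2 dvd p i" "\<not> 3 dvd p i"
      using primes_dvd_imp_eq[of 2 "p i"] primes_dvd_imp_eq[of 3 "p i"] assms(1,2)[OF i] by auto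
    then have "p i mod 6 = 1 \<or> p i mod 6 = 5" by presburger
    then have "int (p i) mod 6 = 1 \<or> int (p i) mod 6 = 5" by presburger
    then have "(int (p i) mod 6) ^ 2 mod 6 = 1" by auto
    then show ?thesis by (simp add: cong_def power_mod)
  qed
  have "[(\<Prod>i=1..k. int (p i) ^ 2) = (\<Prod>i=1..k. 1)] (mod 6)"
    by (rule cong_prod) (use sq in auto)
  then have "[(\<Prod>i=1..k. int (p i) ^ 2) * int (p (k+1)) ^ 2 = 1 * 1] (mod 6)"
    by (intro cong_mult sq) auto
  then have "6 dvd (\<Prod>i=1..k. int (p i) ^ 2) * int (p (k+1)) ^ 2 - 1"
    by (simp add: cong_iff_dvd_diff)
  then have "6 dvd ((\<Prod>i=1..k. int (p i) ^ 2) * int (p (k+1)) ^ 2 - 1)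
      + 6 * ((\<Prod>i=1..k. int (p i) ^ 2) * int (p (k+1)) * j)"
    by (rule dvd_add) simp
  then show ?thesis by (simp add: algebra_simps power2_eq_square)
qed

end

(*
  Modulo 3 the generating function f_3^2 / f_1^2 of B_3, where f_d = prod (1 - q^(d i)), equals
  f_1 f_3, because f_1^3 = f_3 modulo 3. By Euler's pentagonal number theorem the coefficient of
  q^N in f_1 f_3 vanishes unless 4 (6 N + 1) = x^2 + 3 y^2. A prime p with p = 2 modulo 3 is inert
  for this form, so it divides every represented number to an even power, whereas p_{k+1} divides
  6 N + 1 to an odd power for the N in question.
*)
theory Submission
  imports Defs "HOL-Library.Nat_Bijection" "HOL-Computational_Algebra.Formal_Power_Series"
begin

section \<open>Shanks' finite form of the pentagonal number theorem\<close>

text \<open>Writing (q)_n for the product of the 1 - q^i with 1 <= i <= n, the product over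
  \<open>{s<..n}\<close> is (q)_n / (q)_s, so the identity is free of division. With r = s + 1 the
  exponents on the right are the pentagonal numbers r (3 r - 1) / 2 and r (3 r + 1) / 2.\<close>

lemma shanks_identity:
  fixes q :: "'a :: comm_ring_1"
  shows "(\<Sum>s\<le>n. (-1) ^ s * (\<Prod>i\<in>{s<..n}. 1 - q ^ i) * q ^ (s * n + triangle s)) =
         1 + (\<Sum>s<n. (-1) ^ Suc s *
                (q ^ (s * Suc s + triangle (Suc s)) + q ^ (Suc s * Suc s + triangle (Suc s))))"
proof (induction n)
  case 0
  show ?case by simp
next
  case (Suc n)
  define c where "c s = (\<Prod>i\<in>{s<..n}. 1 - q ^ i)" for s
  \<comment> \<open>\<open>t s\<close> is the change of the s-th summand on passing from n to n +
    1.\<close>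
  define t where "t s = (-1) ^ s * c s * (1 - q ^ Suc n) * q ^ (s * Suc n + triangle s)
                      - (-1) ^ s * c s * q ^ (s * n + triangle s)" for s
  \<comment> \<open>For m = n this is one of the two new terms on the right; the extra summand s = n
    + 1 is the other.\<close>
  have telescope: "(\<Sum>s\<le>m. t s) = - ((-1) ^ m * c m * q ^ (Suc m * n + triangle (Suc m)))"
    if "m \<le> n" for m
    using that
  proof (induction m)
    case 0
    show ?case by (simp add: t_def algebra_simps)
  next
    case (Suc m)
    have "{m<..n} = insert (Suc m) {Suc m<..n}"
      using Suc.prems by auto
    then have c: "c m = (1 - q ^ Suc m) * c (Suc m)"
      by (simp add: c_def)
    have "(\<Sum>s\<le>Suc m. t s) = t (Suc m) - (-1) ^ m * c m * q ^ (Suc m * n + triangle (Suc m))"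
      using Suc by simp
    also have "\<dots> = - ((-1) ^ Suc m * c (Suc m) * q ^ (Suc (Suc m) * n + triangle (Suc (Suc m))))"
      unfolding t_def c by (simp add: algebra_simps power_add)
    finally show ?case .
  qed
  have split: "(\<Prod>i\<in>{s<..Suc n}. 1 - q ^ i) = c s * (1 - q ^ Suc n)" if "s \<le> n" for s
  proof -
    have "{s<..Suc n} = insert (Suc n) {s<..n}"
      using that by auto
    then show ?thesis by (simp add: c_def mult.commute)
  qed
  have "(\<Sum>s\<le>Suc n. (-1) ^ s * (\<Prod>i\<in>{s<..Suc n}. 1 - q ^ i) * q ^ (s * Suc n + triangle s))
      = (\<Sum>s\<le>n. (-1) ^ s * c s * (1 - q ^ Suc n) * q ^ (s * Suc n + triangle s))
        + (-1) ^ Suc n * q ^ (Suc n * Suc n + triangle (Suc n))"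
    by (simp add: split mult.assoc)
  also have "(\<Sum>s\<le>n. (-1) ^ s * c s * (1 - q ^ Suc n) * q ^ (s * Suc n + triangle s))
      = (\<Sum>s\<le>n. t s) + (\<Sum>s\<le>n. (-1) ^ s * c s * q ^ (s * n + triangle s))"
    by (simp add: t_def flip: sum.distrib)
  also have "(\<Sum>s\<le>n. t s) = (-1) ^ Suc n * q ^ (n * Suc n + triangle (Suc n))"
    using telescope[of n] by (simp add: c_def algebra_simps)
  finally show ?case
    using Suc.IH by (simp add: c_def algebra_simps)
qed

text \<open>With r = s + 1, completing the square turns 12 r (3 r - 1) + 1 into (6 r - 1)^2, and
  likewise with + in place of -.\<close>

lemma pentagonal_square:
  "24 * int (s * Suc s + triangle (Suc s)) + 1 = (6 * int s + 5) ^ 2"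
  "24 * int (Suc s * Suc s + triangle (Suc s)) + 1 = (6 * int s + 7) ^ 2"
proof -
  have "2 dvd Suc s * Suc (Suc s)" by simp
  then have "2 * triangle (Suc s) = Suc s * Suc (Suc s)"
    unfolding triangle_def by simp
  then have "2 * int (triangle (Suc s)) = (int s + 1) * (int s + 2)"
    by (metis (no_types, opaque_lifting) add.assoc of_nat_Suc of_nat_mult of_nat_numeral one_add_one add.commute)
  then show "24 * int (s * Suc s + triangle (Suc s)) + 1 = (6 * int s + 5) ^ 2"
    "24 * int (Suc s * Suc s + triangle (Suc s)) + 1 = (6 * int s + 7) ^ 2"
    by (simp_all add: power2_eq_square algebra_simps)
qed

text \<open>The bound \<open>m \<le> n\<close> makes the finite product agree with the infinite one
  at coefficient m. The surviving exponents are d e with 24 e + 1 a square; multiplying through by d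
  states this without division.\<close>

lemma euler_product_nth_nonzero:
  fixes d n m :: nat
  assumes "d > 0" "m \<le> n"
    and nz: "fps_nth (\<Prod>i=1..n. 1 - (fps_X ^ d :: int fps) ^ i) m \<noteq> 0"
  shows "\<exists>x::int. 24 * int m + int d = int d * x ^ 2"
proof -
  let ?q = "fps_X ^ d :: int fps"
  let ?r = "\<lambda>s. (-1) ^ s * (\<Prod>i\<in>{s<..n}. 1 - ?q ^ i) * ?q ^ (s * n + triangle s)"
  \<comment> \<open>For s > 0 all exponents in the summand exceed n, so only s = 0, the Euler
    product itself, reaches coefficient m.\<close>
  have tail: "fps_nth (?r s) m = 0" if "s > 0" for s
  proof -
    have "n < s * n + triangle s"
      using that by (cases s) auto
    also have "\<dots> \<le> d * (s * n + triangle s)"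
      using \<open>d > 0\<close> by (cases d) auto
    finally have "m < d * (s * n + triangle s)"
      using \<open>m \<le> n\<close> by simp
    then show ?thesis
      by (simp add: fps_X_power_mult_right_nth flip: power_mult)
  qed
  have "{..n} = insert 0 {1..n}" by auto
  then have "(\<Sum>s\<le>n. ?r s) = ?r 0 + (\<Sum>s=1..n. ?r s)" by simp
  moreover have "fps_nth (\<Sum>s=1..n. ?r s) m = 0"
    by (simp only: fps_sum_nth, intro sum.neutral ballI tail) simp
  moreover have "?r 0 = (\<Prod>i=1..n. 1 - ?q ^ i)"
    by (simp add: atLeastSucAtMost_greaterThanAtMost)
  ultimately have coeff: "fps_nth (\<Sum>s\<le>n. ?r s) m \<noteq> 0"
    using nz by (simp only: fps_add_nth add_0_right not_False_eq_True)
  have shift: "\<exists>x::int. 24 * int m + int d = int d * x ^ 2"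
    if "24 * int e + 1 = x ^ 2" "m = d * e" for e x
  proof
    have "24 * int m + int d = int d * (24 * int e + 1)"
      unfolding that(2) by (simp add: algebra_simps)
    then show "24 * int m + int d = int d * x ^ 2" using that(1) by simp
  qed
  show ?thesis
  proof (rule ccontr)
    assume no: "\<not> ?thesis"
    \<comment> \<open>The constant term 1 of the series belongs to the pentagonal number 0.\<close>
    have m0: "m \<noteq> d * 0"
      using no shift[where e = 0 and x = 1] by fastforce
    have "m \<noteq> d * (s * Suc s + triangle (Suc s))" for s
      using no shift[OF pentagonal_square(1)] by blast
    moreover have "m \<noteq> d * (Suc s * Suc s + triangle (Suc s))" for s
      using no shift[OF pentagonal_square(2)] by blast
    moreover have "fps_nth ((-1) ^ k * (?q ^ a + ?q ^ b)) m = 0"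
      if "m \<noteq> d * a" "m \<noteq> d * b" for k a b
    proof -
      have "(-1 :: int fps) ^ k = 1 \<or> (-1 :: int fps) ^ k = -1"
        by (cases "even k") auto
      then show ?thesis
        using that by (auto simp: simp flip: power_mult)
    qed
    ultimately have "fps_nth ((-1) ^ Suc s *
        (?q ^ (s * Suc s + triangle (Suc s)) + ?q ^ (Suc s * Suc s + triangle (Suc s)))) m = 0" for s
      by blast
    then have "fps_nth (\<Sum>s\<le>n. ?r s) m = fps_nth 1 m"
      unfolding shanks_identity fps_add_nth fps_sum_nth by (simp only: sum.neutral_const add_0_right)
    also have "\<dots> = 0"
      using m0 by simp
    finally have "fps_nth (\<Sum>s\<le>n. ?r s) m = 0" .
    with coeff show False by simp
  qed
qed

section \<open>Partitions with parts in a given set\<close>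

definition partitions_in :: "nat set \<Rightarrow> nat \<Rightarrow> nat multiset set" where
  "partitions_in S m = {L. set_mset L \<subseteq> S \<and> sum_mset L = m}"

text \<open>If 0 were in S, zeros could be added freely and \<open>card\<close> of an infinite set
  would return the default 0; hence the assumptions below that S omits 0.\<close>

definition partition_fps :: "nat set \<Rightarrow> int fps" where
  "partition_fps S = Abs_fps (\<lambda>m. int (card (partitions_in S m)))"

lemma member_le_sum_mset:
  fixes x :: nat
  shows "x \<in># L \<Longrightarrow> x \<le> sum_mset L"
  by (induction L) auto

lemma finite_partitions_in:
  assumes "0 \<notin> S"
  shows "finite (partitions_in S m)"
proof (rule finite_subset)
  show "partitions_in S m \<subseteq> mset ` {xs. set xs \<subseteq> {..m} \<and> length xs \<le> m}"
  proof
    fix L assume L: "L \<in> partitions_in S m"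
    obtain xs where xs: "mset xs = L" using ex_mset by blast
    have "is_partition L"
      using L assms by (auto simp: partitions_in_def is_partition_def intro!: Nat.gr0I)
    then have "length xs \<le> m"
      using L size_le_sum_mset[of L] xs by (auto simp: partitions_in_def)
    moreover have "x \<le> m" if "x \<in># L" for x
      using L member_le_sum_mset[OF that] by (simp add: partitions_in_def)
    then have "set xs \<subseteq> {..m}" using xs by auto
    ultimately show "L \<in> mset ` {xs. set xs \<subseteq> {..m} \<and> length xs \<le> m}"
      using xs by blast
  qed
qed (intro finite_imageI finite_lists_length_le, simp)

text \<open>One copy of a is removed if there is any; further copies may remain, so the recursion
  returns to \<open>insert a S\<close>.\<close>

lemma partitions_in_insert:
  "partitions_in (insert a S) m =
     partitions_in S m \<union> (if a \<le> m then add_mset a ` partitions_in (insert a S) (m - a) else {})"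
  (is "?A = ?B")
proof
  show "?A \<subseteq> ?B"
  proof
    fix L assume L: "L \<in> ?A"
    show "L \<in> ?B"
    proof (cases "a \<in># L")
      case True
      then obtain M where M: "L = add_mset a M" by (meson mset_add)
      with L have "a \<le> m" "M \<in> partitions_in (insert a S) (m - a)"
        by (auto simp: partitions_in_def)
      with M show ?thesis by auto
    next
      case False
      with L show ?thesis by (auto simp: partitions_in_def)
    qed
  qed
qed (auto simp: partitions_in_def split: if_splits)

text \<open>At coefficient m, multiplying by 1 - X^a subtracts the number of partitions in which a
  occurs.\<close>

lemma partition_fps_insert:
  assumes "0 \<notin> insert a S" "a \<notin> S"
  shows "partition_fps (insert a S) * (1 - fps_X ^ a) = partition_fps S"
proof (rule fps_ext)
  fix m
  have inj: "inj_on (add_mset a) A" for A :: "nat multiset set"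
    by (simp add: inj_on_def)
  have "card (partitions_in (insert a S) m) =
      card (partitions_in S m) + (if a \<le> m then card (partitions_in (insert a S) (m - a)) else 0)"
  proof (cases "a \<le> m")
    case True
    let ?I = "add_mset a ` partitions_in (insert a S) (m - a)"
    have "a \<notin># L" if "L \<in> partitions_in S m" for L
      using that assms(2) unfolding partitions_in_def by blast
    then have disj: "partitions_in S m \<inter> ?I = {}"
      by fastforce
    have "0 \<notin> S"
      using assms(1) by simp
    have "partitions_in (insert a S) m = partitions_in S m \<union> ?I"
      using True partitions_in_insert[of a S m] by (simp only: if_True)
    then have "card (partitions_in (insert a S) m) = card (partitions_in S m) + card ?I"
      using card_Un_disjoint[OF finite_partitions_in[OF \<open>0 \<notin> S\<close>]
          finite_imageI[OF finite_partitions_in[OF assms(1)]] disj] by simp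
    with True show ?thesis
      by (simp only: card_image[OF inj] if_True)
  next
    case False
    then have "partitions_in (insert a S) m = partitions_in S m"
      using partitions_in_insert[of a S m] by (simp only: if_False Un_empty_right)
    with False show ?thesis by (simp only: if_False add_0_right)
  qed
  then show "fps_nth (partition_fps (insert a S) * (1 - fps_X ^ a)) m = fps_nth (partition_fps S) m"
    by (simp add: partition_fps_def right_diff_distrib fps_X_power_mult_right_nth)
qed

lemma partition_fps_mult_prod:
  assumes "finite S" "0 \<notin> S"
  shows "partition_fps S * (\<Prod>i\<in>S. 1 - fps_X ^ i) = 1"
  using assms
proof (induction S rule: finite_induct)
  case empty
  have "partitions_in {} m = (if m = 0 then {{#}} else {})" for m
    by (auto simp: partitions_in_def)
  then show ?case by (auto simp: partition_fps_def fps_eq_iff)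
next
  case (insert a S)
  have "partition_fps (insert a S) * (\<Prod>i\<in>insert a S. 1 - fps_X ^ i)
      = (partition_fps (insert a S) * (1 - fps_X ^ a)) * (\<Prod>i\<in>S. 1 - fps_X ^ i)"
    using insert.hyps by (simp add: mult.assoc)
  also have "\<dots> = 1"
    using insert by (subst partition_fps_insert) auto
  finally show ?case .
qed

lemma partitions_in_three_regular:
  assumes "m \<le> N"
  shows "{L. three_regular L \<and> sum_mset L = m} = partitions_in {i \<in> {1..N}. \<not> 3 dvd i} m"
  using assms
  by (fastforce simp: partitions_in_def three_regular_def is_partition_def dest: member_le_sum_mset)

text \<open>Parts of a partition of m are at most m, so parts up to N suffice. Grouping the pairs by
  the sum of the first component gives the Cauchy product.\<close>

lemma B3_eq_nth:
  assumes "m \<le> N"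
  shows "int (B3 (int m)) = fps_nth (partition_fps {i \<in> {1..N}. \<not> 3 dvd i} ^ 2) m"
proof -
  let ?P = "partitions_in {i \<in> {1..N}. \<not> 3 dvd i}"
  have "{(L, M). three_regular L \<and> three_regular M \<and> int (sum_mset L + sum_mset M) = int m}
      = (\<Union>i\<le>m. {L. three_regular L \<and> sum_mset L = i} \<times> {L. three_regular L \<and> sum_mset L = m - i})"
    by (simp only: of_nat_eq_iff) auto
  also have "\<dots> = (\<Union>i\<le>m. ?P i \<times> ?P (m - i))"
    using assms by (intro SUP_cong refl) (simp only: atMost_iff partitions_in_three_regular[of _ N])
  finally have "B3 (int m) = card (\<Union>i\<le>m. ?P i \<times> ?P (m - i))"
    by (simp add: B3_def)
  also have "\<dots> = (\<Sum>i\<le>m. card (?P i \<times> ?P (m - i)))"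
    by (rule card_UN_disjoint) (auto simp: finite_partitions_in, auto simp: partitions_in_def)
  finally show ?thesis
    by (simp add: card_cartesian_product power2_eq_square fps_mult_nth partition_fps_def atMost_atLeast0)
qed

section \<open>Reduction modulo 3\<close>

text \<open>This is congruence modulo c and q^(N+1); it lets finite products stand for infinite
  ones.\<close>

definition cong_fps :: "nat \<Rightarrow> int \<Rightarrow> int fps \<Rightarrow> int fps \<Rightarrow> bool" where
  "cong_fps N c f g \<longleftrightarrow> (\<forall>i\<le>N. [fps_nth f i = fps_nth g i] (mod c))"

lemma cong_fps_refl [simp]: "cong_fps N c f f"
  by (simp add: cong_fps_def)

lemma cong_fps_sym: "cong_fps N c f g \<Longrightarrow> cong_fps N c g f"
  by (simp add: cong_fps_def cong_sym_eq)

lemma cong_fps_trans [trans]: "cong_fps N c f g \<Longrightarrow> cong_fps N c g h \<Longrightarrow> cong_fps N c f h"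
  unfolding cong_fps_def by (blast intro: cong_trans)

lemma cong_fps_mult:
  assumes "cong_fps N c f f'" "cong_fps N c g g'"
  shows "cong_fps N c (f * g) (f' * g')"
  using assms unfolding cong_fps_def fps_mult_nth
  by (intro allI impI cong_sum cong_mult) auto

lemma cong_fps_prod:
  assumes "\<And>x. x \<in> A \<Longrightarrow> cong_fps N c (f x) (g x)"
  shows "cong_fps N c (prod f A) (prod g A)"
  using assms by (induction A rule: infinite_finite_induct) (auto intro: cong_fps_mult)

lemma cong_fps_cube: "cong_fps N 3 ((1 - f) ^ 3) (1 - f ^ 3)"
proof -
  have "(1 - f) ^ 3 = (1 - f ^ 3) + fps_const 3 * (f ^ 2 - f)"
    by (simp add: power2_eq_square power3_eq_cube algebra_simps flip: numeral_fps_const)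
  then show ?thesis
    by (simp only: cong_fps_def fps_add_nth fps_mult_left_const_nth cong_iff_dvd_diff) simp
qed

text \<open>\<open>E d n\<close> truncates f_d. The cut-offs 3 N and N fit together: {1..3N} is the
  disjoint union of the non-multiples of 3 and the 3 i with i <= N, so
  \<open>A * E 1 (3 * N) = E 3 N\<close> holds exactly.\<close>

lemma generating_function_mod_3:
  fixes N :: nat
  defines "A \<equiv> partition_fps {i \<in> {1..3 * N}. \<not> 3 dvd i}"
  defines "E \<equiv> \<lambda>d n. \<Prod>i=1..n. 1 - (fps_X ^ d) ^ i"
  shows "cong_fps N 3 (A ^ 2) (E 3 N * E 1 (3 * N))"
proof -
  let ?R = "{i \<in> {1..3 * N}. \<not> 3 dvd i}" and ?T = "(*) 3 ` {1..N}"
  \<comment> \<open>\<open>H\<close> is the inverse of \<open>E 3 N\<close>, needed to cancel that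
    factor in a congruence.\<close>
  define H where "H = partition_fps ?T"
  have T: "(\<Prod>i\<in>?T. 1 - fps_X ^ i) = E 3 N"
    unfolding E_def by (subst prod.reindex) (auto simp: inj_on_def simp flip: power_mult)
  have H: "H * E 3 N = 1"
    unfolding H_def T[symmetric] by (rule partition_fps_mult_prod) auto
  have "{1..3 * N} = ?R \<union> ?T" by (auto elim!: dvdE)
  then have "E 1 (3 * N) = (\<Prod>i\<in>?R \<union> ?T. 1 - fps_X ^ i)"
    by (simp only: E_def power_one_right)
  also have "\<dots> = (\<Prod>i\<in>?R. 1 - fps_X ^ i) * E 3 N"
    unfolding T[symmetric] by (rule prod.union_disjoint) auto
  finally have "A * E 1 (3 * N) = (A * (\<Prod>i\<in>?R. 1 - fps_X ^ i)) * E 3 N"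
    by (simp add: mult.assoc)
  also have "A * (\<Prod>i\<in>?R. 1 - fps_X ^ i) = 1"
    unfolding A_def by (rule partition_fps_mult_prod) auto
  finally have A: "A * E 1 (3 * N) = E 3 N" by simp

  \<comment> \<open>The factors with i > N affect only exponents above N. Adding them gives as many
    factors as \<open>E 1 (3 * N)\<close> has, so the cubes can be compared factor by
    factor.\<close>
  have "cong_fps N 3 (E 3 N * 1) (E 3 N * (\<Prod>i\<in>{N<..3 * N}. 1 - (fps_X ^ 3) ^ i))"
  proof (intro cong_fps_mult cong_fps_refl)
    have "cong_fps N 3 1 (1 - (fps_X ^ 3) ^ i)" if "i \<in> {N<..3 * N}" for i
      using that by (auto simp: cong_fps_def simp flip: power_mult)
    then have "cong_fps N 3 (\<Prod>i\<in>{N<..3 * N}. 1) (\<Prod>i\<in>{N<..3 * N}. 1 - (fps_X ^ 3) ^ i)"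
      by (rule cong_fps_prod)
    then show "cong_fps N 3 1 (\<Prod>i\<in>{N<..3 * N}. 1 - (fps_X ^ 3) ^ i)" by simp
  qed
  also have "E 3 N * (\<Prod>i\<in>{N<..3 * N}. 1 - (fps_X ^ 3) ^ i)
      = (\<Prod>i\<in>{1..N} \<union> {N<..3 * N}. 1 - (fps_X ^ 3) ^ i)"
    unfolding E_def by (rule prod.union_disjoint[symmetric]) auto
  also have "{1..N} \<union> {N<..3 * N} = {1..3 * N}" by auto
  also have "cong_fps N 3 (\<Prod>i=1..3 * N. 1 - (fps_X ^ 3) ^ i) (\<Prod>i=1..3 * N. (1 - fps_X ^ i) ^ 3)"
  proof (rule cong_fps_prod)
    fix i
    have "(fps_X ^ 3) ^ i = ((fps_X ^ i) ^ 3 :: int fps)"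
      by (simp add: mult.commute flip: power_mult)
    then show "cong_fps N 3 (1 - (fps_X ^ 3) ^ i) ((1 - fps_X ^ i) ^ 3)"
      using cong_fps_sym[OF cong_fps_cube] by simp
  qed
  finally have "cong_fps N 3 (E 3 N) (E 1 (3 * N) ^ 3)"
    by (simp add: E_def prod_power_distrib)
  \<comment> \<open>On the left \<open>H\<close> cancels \<open>E 3 N\<close>, leaving
    \<open>A ^ 2\<close>; on the right \<open>A\<close> absorbs two of the three factors
    \<open>E 1 (3 * N)\<close>.\<close>
  then have "cong_fps N 3 (A ^ 2 * H * E 3 N) (A ^ 2 * H * E 1 (3 * N) ^ 3)"
    by (intro cong_fps_mult cong_fps_refl)
  also have "A ^ 2 * H * E 1 (3 * N) ^ 3 = (A * E 1 (3 * N)) ^ 2 * H * E 1 (3 * N)"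
    by (simp add: power2_eq_square power3_eq_cube mult_ac)
  also have "\<dots> = (H * E 3 N) * (E 3 N * E 1 (3 * N))"
    unfolding A by (simp add: power2_eq_square mult_ac)
  finally show ?thesis
    by (simp add: H mult.assoc)
qed

lemma B3_not_cong_0_imp_norm_form:
  assumes "\<not> [B3 m = 0] (mod 3)"
  shows "\<exists>x y :: int. 4 * (6 * m + 1) = x ^ 2 + 3 * y ^ 2"
proof -
  define E where "E = (\<lambda>d n. \<Prod>i=1..n. 1 - (fps_X ^ d :: int fps) ^ i)"
  have "m \<ge> 0"
  proof (rule ccontr)
    assume "\<not> m \<ge> 0"
    then have "int s \<noteq> m" for s by auto
    then have "B3 m = 0" unfolding B3_def by (simp only:) simp
    then show False using assms by simp
  qed
  then obtain N where N: "m = int N" using nonneg_int_cases by blast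
  have "[int (B3 m) = fps_nth (E 3 N * E 1 (3 * N)) N] (mod 3)"
    using generating_function_mod_3[of N] B3_eq_nth[of N "3 * N"]
    by (simp add: N E_def cong_fps_def)
  moreover have "\<not> [int (B3 m) = 0] (mod 3)"
    using assms cong_int_iff[of "B3 m" 0 3] by simp
  ultimately have "fps_nth (E 3 N * E 1 (3 * N)) N \<noteq> 0"
    by auto
  then obtain i where i: "i \<le> N" "fps_nth (E 3 N) i * fps_nth (E 1 (3 * N)) (N - i) \<noteq> 0"
    unfolding fps_mult_nth by (meson atLeastAtMost_iff sum.neutral)
  obtain y :: int where y: "24 * int i + int 3 = int 3 * y ^ 2"
    using euler_product_nth_nonzero[of 3 i N] i by (auto simp: E_def)
  obtain x :: int where x: "24 * int (N - i) + int 1 = int 1 * x ^ 2"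
    using euler_product_nth_nonzero[of 1 "N - i" "3 * N"] i by (simp only: E_def) fastforce
  \<comment> \<open>The two exponents add up to N, and the offsets 3 and 1 to 4.\<close>
  have "4 * (6 * m + 1) = x ^ 2 + 3 * y ^ 2"
    using x y i N by (simp add: of_nat_diff)
  then show ?thesis by blast
qed

section \<open>Primes that are inert for the form \<open>x\<^sup>2 + 3 y\<^sup>2\<close>\<close>

lemma fermat_int:
  fixes a :: int
  assumes "prime p" "\<not> int p dvd a"
  shows "[a ^ (p - 1) = 1] (mod int p)"
proof -
  define b where "b = nat (a mod int p)"
  have b: "int b = a mod int p"
    using assms(1) by (simp add: b_def prime_gt_0_nat)
  then have "\<not> p dvd b"
    using assms(2) by (metis dvd_mod_iff dvd_refl int_dvd_int_iff)
  then have "[b ^ (p - 1) = 1] (mod p)"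
    by (rule fermat_theorem[OF assms(1)])
  then have "[int b ^ (p - 1) = 1] (mod int p)"
    by (metis cong_int_iff of_nat_1 of_nat_power)
  then show ?thesis
    by (simp add: b cong_def power_mod)
qed

text \<open>Cubing is injective modulo p because 3 is prime to p - 1: with p - 1 = 3 m + 1, Fermat
  makes a^(3m) the inverse of a, and it depends only on a^3.\<close>

lemma cube_cong_imp_cong:
  fixes a b :: int
  assumes p: "prime p" "p mod 3 = 2" and ab: "[a ^ 3 = b ^ 3] (mod int p)"
  shows "[a = b] (mod int p)"
proof -
  have dvd_iff: "int p dvd a \<longleftrightarrow> int p dvd b"
    using cong_dvd_iff[OF ab] p(1) prime_dvd_power_iff[of "int p" 3 a] prime_dvd_power_iff[of "int p" 3 b]
    by simp
  show ?thesis
  proof (cases "int p dvd a")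
    case True
    then have "int p dvd b"
      using dvd_iff by simp
    with True show ?thesis
      by (simp add: cong_iff_dvd_diff)
  next
    case False
    then have "\<not> int p dvd b"
      using dvd_iff by simp
    define m where "m = p div 3"
    have m: "p - 1 = 3 * m + 1"
      using p(2) unfolding m_def by presburger
    have am: "[a ^ (3 * m) * a = 1] (mod int p)"
      using fermat_int[OF p(1) False] unfolding m by (simp add: mult.commute[of _ a])
    have "[b ^ (3 * m) * b = 1] (mod int p)"
      using fermat_int[OF p(1) \<open>\<not> int p dvd b\<close>] unfolding m by (simp add: mult.commute[of _ b])
    moreover have "[a ^ (3 * m) = b ^ (3 * m)] (mod int p)"
      using cong_pow[OF ab, of m] by (simp add: power_mult)
    ultimately have bm: "[a ^ (3 * m) * b = 1] (mod int p)"
      by (meson cong_mult cong_refl cong_trans)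
    have "[a = a * (a ^ (3 * m) * b)] (mod int p)"
      using cong_mult[OF cong_refl[of a] cong_sym[OF bm]] by simp
    also have "a * (a ^ (3 * m) * b) = (a ^ (3 * m) * a) * b"
      by (simp add: mult_ac)
    also have "[(a ^ (3 * m) * a) * b = 1 * b] (mod int p)"
      by (rule cong_mult[OF am cong_refl])
    finally show ?thesis by simp
  qed
qed

text \<open>A nontrivial zero modulo p would produce a nontrivial cube root of unity. Injectivity of
  cubing forces x = 3 y modulo p, where the form becomes 12 y^2 and p does not divide 12.\<close>

lemma inert_prime_dvd_norm_form:
  fixes x y :: int
  assumes p: "prime p" "p \<ge> 5" "p mod 3 = 2" and dvd: "int p dvd x ^ 2 + 3 * y ^ 2"
  shows "int p dvd x" "int p dvd y"
proof -
  have ip: "prime (int p)" using p(1) by simp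
  have not12: "\<not> int p dvd 12"
  proof
    assume "int p dvd 12"
    then have "int p dvd int (2 * 2 * 3)" by simp
    then have "p dvd 2 * 2 * 3" by (simp only: int_dvd_int_iff)
    then have "p dvd 2 \<or> p dvd 3"
      using p(1) by (metis prime_dvd_multD)
    then show False using p(2) by (auto dest: dvd_imp_le)
  qed
  \<comment> \<open>Modulo \<open>x\<^sup>2 = - 3 y\<^sup>2\<close> the cubes of \<open>x - y\<close> and \<open>2 y\<close> agree: their quotient is \<open>(-1 + \<surd>-3) / 2\<close>.\<close>
  have "(x - y) ^ 3 - (2 * y) ^ 3 = (x - 3 * y) * (x ^ 2 + 3 * y ^ 2)"
    by (simp add: power2_eq_square power3_eq_cube algebra_simps)
  then have "[(x - y) ^ 3 = (2 * y) ^ 3] (mod int p)"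
    using dvd by (simp add: cong_iff_dvd_diff)
  then have "[x - y = 2 * y] (mod int p)"
    by (rule cube_cong_imp_cong[OF p(1,3)])
  then have d: "int p dvd x - 3 * y"
    by (simp add: cong_iff_dvd_diff)
  have "12 * y ^ 2 = (x ^ 2 + 3 * y ^ 2) - (x - 3 * y) * (x + 3 * y)"
    by (simp add: power2_eq_square algebra_simps)
  then have "int p dvd 12 * y ^ 2"
    using dvd d by (metis dvd_diff dvd_mult2)
  then show y: "int p dvd y"
    using ip not12 by (metis prime_dvd_mult_iff prime_dvd_power)
  have "x = (x - 3 * y) + 3 * y" by simp
  then show "int p dvd x"
    using d y by (metis dvd_add dvd_mult)
qed

text \<open>Infinite descent: p divides x and y, so p^2 cancels and the exponent drops by 2, until
  exponent 1 would make p divide c.\<close>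

lemma norm_form_even_multiplicity:
  fixes x y c :: int
  assumes p: "prime p" "p \<ge> 5" "p mod 3 = 2" and c: "\<not> int p dvd c"
  shows "x ^ 2 + 3 * y ^ 2 \<noteq> int p ^ (2 * e + 1) * c"
proof (induction e arbitrary: x y)
  case (0 x y)
  show ?case
  proof
    assume eq: "x ^ 2 + 3 * y ^ 2 = int p ^ (2 * 0 + 1) * c"
    then have "int p dvd x ^ 2 + 3 * y ^ 2" by simp
    then obtain u v where "x = int p * u" "y = int p * v"
      using inert_prime_dvd_norm_form[OF p] by (meson dvdE)
    with eq have "int p * (int p * (u ^ 2 + 3 * v ^ 2)) = int p * c"
      by (simp add: power2_eq_square algebra_simps)
    then have "c = int p * (u ^ 2 + 3 * v ^ 2)"
      using p(2) by simp
    with c show False by simp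
  qed
next
  case (Suc e x y)
  show ?case
  proof
    assume eq: "x ^ 2 + 3 * y ^ 2 = int p ^ (2 * Suc e + 1) * c"
    then have "int p dvd x ^ 2 + 3 * y ^ 2" by simp
    then obtain u v where "x = int p * u" "y = int p * v"
      using inert_prime_dvd_norm_form[OF p] by (meson dvdE)
    with eq have "int p ^ 2 * (u ^ 2 + 3 * v ^ 2) = int p ^ 2 * (int p ^ (2 * e + 1) * c)"
      by (simp add: power2_eq_square algebra_simps)
    then have "u ^ 2 + 3 * v ^ 2 = int p ^ (2 * e + 1) * c"
      using p(2) by simp
    with Suc show False by blast
  qed
qed

text \<open>Q may itself be divisible by p, since the primes of the theorem may repeat; its p-part
  enters squared and keeps the exponent odd.\<close>

lemma norm_form_neq_square_mult_inert:
  fixes x y c Q :: int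
  assumes p: "prime p" "p \<ge> 5" "p mod 3 = 2" and c: "\<not> int p dvd c" and "Q \<noteq> 0"
  shows "x ^ 2 + 3 * y ^ 2 \<noteq> Q ^ 2 * int p * c"
proof -
  have ip: "prime (int p)" using p(1) by simp
  then have "\<not> is_unit (int p)" by auto
  then obtain r where r: "Q = int p ^ multiplicity (int p) Q * r" "\<not> int p dvd r"
    using multiplicity_decompose'[of Q "int p"] \<open>Q \<noteq> 0\<close> by blast
  have "\<not> int p dvd r ^ 2 * c"
    using ip r(2) c by (metis prime_dvd_mult_iff prime_dvd_power)
  moreover have "Q ^ 2 * int p * c = int p ^ (2 * multiplicity (int p) Q + 1) * (r ^ 2 * c)"
    by (subst r(1)) (simp add: power_mult_distrib algebra_simps flip: power_mult)
  ultimately show ?thesis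
    using norm_form_even_multiplicity[OF p] by metis
qed

theorem theorem1p3:
  fixes k n :: nat and p :: "nat \<Rightarrow> nat" and j :: int
  assumes "\<And>i. i \<in> {1..k+1} \<Longrightarrow> prime (p i)"
    and "\<And>i. i \<in> {1..k+1} \<Longrightarrow> p i \<ge> 5"
    and "\<And>i. i \<in> {1..k+1} \<Longrightarrow> \<not> [p i = 1] (mod 6)"
    and "\<not> [j = 0] (mod int (p (k+1)))"
  shows "[B3 ((\<Prod>i=1..k. int (p i) ^ 2) * int (p (k+1)) ^ 2 * int n
            + ((\<Prod>i=1..k. int (p i) ^ 2) * int (p (k+1)) * (6 * j + int (p (k+1))) - 1) div 6)
          = 0] (mod 3)"
proof (rule ccontr)
  define q where "q = p (k + 1)"
  define Q where "Q = (\<Prod>i=1..k. int (p i))"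
  have Q2: "(\<Prod>i=1..k. int (p i) ^ 2) = Q ^ 2"
    by (simp add: Q_def prod_power_distrib)
  have q: "prime q" "q \<ge> 5" "\<not> [q = 1] (mod 6)"
    using assms(1-3)[of "k + 1"] by (simp_all add: q_def)
  have "\<not> 2 dvd q" "\<not> 3 dvd q"
    using primes_dvd_imp_eq[of 2 q] primes_dvd_imp_eq[of 3 q] q(1,2) by auto
  \<comment> \<open>A number prime to 6 and not 1 modulo 6 is 5 modulo 6.\<close>
  then have q3: "q mod 3 = 2"
    using q(3) unfolding cong_def by presburger
  have "Q \<noteq> 0"
    unfolding Q_def using assms(2) by fastforce
  define m where "m = (Q ^ 2 * int q * (6 * j + int q) - 1) div 6"
  \<comment> \<open>\<open>c\<close> is the cofactor of \<open>Q ^ 2 * int q\<close> in 4 (6 M + 1),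
    where M is the argument of \<open>B3\<close>.\<close>
  define c where "c = 4 * (6 * j + int q * (6 * int n + 1))"
  have m: "6 * m = Q ^ 2 * int q * (6 * j + int q) - 1"
    using exact_division[of k p j] assms(1,2) unfolding m_def Q2 q_def by simp
  assume "\<not> ?thesis"
  then obtain x y :: int where "4 * (6 * (Q ^ 2 * int q ^ 2 * int n + m) + 1) = x ^ 2 + 3 * y ^ 2"
    using B3_not_cong_0_imp_norm_form unfolding Q2 m_def q_def by blast
  then have "x ^ 2 + 3 * y ^ 2 = 24 * (Q ^ 2 * int q ^ 2 * int n) + 4 * (6 * m + 1)"
    by simp
  also have "\<dots> = Q ^ 2 * int q * c"
    unfolding m c_def by (simp add: power2_eq_square algebra_simps)
  finally have "x ^ 2 + 3 * y ^ 2 = Q ^ 2 * int q * c" .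
  moreover have "\<not> int q dvd c"
  proof
    assume "int q dvd c"
    \<comment> \<open>Modulo q only 24 j is left of \<open>c\<close>, and q divides neither 24 nor
      j.\<close>
    then have "int q dvd 24 * j + int q * (4 * (6 * int n + 1))"
      by (simp add: c_def algebra_simps)
    then have "int q dvd 24 * j"
      by (simp add: dvd_add_left_iff)
    moreover have "coprime (int q) 24"
    proof -
      have "coprime q 2" "coprime q 3"
        using \<open>\<not> 2 dvd q\<close> \<open>\<not> 3 dvd q\<close> by (simp_all add: coprime_commute[of q] prime_imp_coprime)
      then have "coprime q (2 ^ 3 * 3)"
        by (intro coprime_mult_right_iff[THEN iffD2] conjI coprime_power_right_iff[THEN iffD2] disjI1)
      then have "coprime (int q) (int (2 ^ 3 * 3))"
        by (simp only: coprime_int_iff)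
      then show ?thesis by simp
    qed
    ultimately have "int q dvd j"
      by (simp add: coprime_dvd_mult_right_iff)
    with assms(4) show False by (simp add: cong_0_iff q_def)
  qed
  ultimately show False
    using norm_form_neq_square_mult_inert[OF q(1,2) q3 _ \<open>Q \<noteq> 0\<close>] by blast
qed

end
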